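(* In the setting described in the context, fix a stage $t$ and an energy level $e$, and let $v_t(e)=\partial V_t(e)/\partial e$, a random variable through the price $\pi_t^{\mathrm{elec}}$. Put $$a=v_t^{\mathrm{post}}(e+\eta P_t^+),\qquad b=v_t^{\mathrm{post}}(e),\qquad c=v_t^{\mathrm{post}}\bigl(e+P_t^-/\eta\bigr).$$ Then the probability distribution of $v_t(e)$ is the following mixture of point masses and a density: - a point mass $F_t^{\mathrm{elec}}[\eta a]$ at $x=a$; - density $\eta f_t^{\mathrm{elec}}[\eta x]$ for $a<x<b$; - a point mass $F_t^{\mathrm{elec}}\bigl[\tfrac{b}{\eta}+\pi^{\mathrm{deg}}\bigr]-F_t^{\mathrm{elec}}[\eta b]$ at $x=b$; - density $\tfrac1\eta f_t^{\mathrm{elec}}\bigl[\tfrac{x}{\eta}+\pi^{\mathrm{deg}}\bigr]$ for $b<x<c$; - a point mass $1-F_t^{\mathrm{elec}}\bigl[\tfrac{c}{\eta}+\pi^{\mathrm{deg}}\bigr]$ at $x=c$; - zero elsewhere.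
   Context: An aggregator of electric vehicles operates over a finite horizon $t\in\{1,\dots,T\}$. Data: power bounds $P_t^-\le 0\le P_t^+$, energy bounds $E_t^-\le E_t^+$, a charging/discharging efficiency $\eta\in(0,1]$, and a constant marginal battery degradation cost $\pi^{\mathrm{deg}}\ge 0$. The real-time electricity prices $\pi_t^{\mathrm{elec}}$ are stage-wise independent random variables with probability density $f_t^{\mathrm{elec}}$ and cumulative distribution function $F_t^{\mathrm{elec}}$. At stage $t$, given the energy level $e_t$ and the price $\pi_t^{\mathrm{elec}}$, an action $a_t=(p_t^{\mathrm c},p_t^{\mathrm d})$ (charging and discharging power) is chosen from the feasible set $\Omega_t$ defined by $$0\le p_t^{\mathrm c}\le P_t^+,\qquad P_t^-\le p_t^{\mathrm d}\le 0,\qquad p_t^{\mathrm c}\,p_t^{\mathrm d}=0,$$ $$e_{t+1}=e_t+\eta\,p_t^{\mathrm c}+p_t^{\mathrm d}/\eta,\qquad E_t^-\le e_{t+1}\le E_t^+ .$$ The value function (random through $\pi_t^{\mathrm{elec}}$) and the post-decision value function are defined by the Bellman recursion $$V_t(e_t)=\max_{a_t\in\Omega_t}\Bigl\{-\bigl[\pi_t^{\mathrm{elec}}(p_t^{\mathrm c}+p_t^{\mathrm d})-\pi^{\mathrm{deg}}p_t^{\mathrm d}\bigr]+V_t^{\mathrm{post}}(e_{t+1})\Bigr\},\qquad V_t^{\mathrm{post}}(e_{t+1})=\mathbb E_{\pi_{t+1}^{\mathrm{elec}}}\bigl[V_{t+1}(e_{t+1})\bigr],$$ started at $t=T$ from a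 predefined terminal condition on $v_T^{\mathrm{post}}$ that encodes the final energy requirement. The function $V_t^{\mathrm{post}}$ is concave in the energy level, and its derivative $v_t^{\mathrm{post}}(e)=\partial V_t^{\mathrm{post}}(e)/\partial e$ is well-defined and monotonically non-increasing.
   Formalization: Assumes F[ηb] ≤ F[b/η+π^deg] (else the claimed mass at b is negative); v^post is taken for V^post restricted to [E_t^-,E_t^+], so it is +∞ below and −∞ above its domain, and e, e+ηP^+, e+P^-/η must not be endpoints of that domain, where v_t(e) need not exist. *)

theory Defs
  imports "HOL-Probability.Probability"
begin

text \<open>
  Value functions take values in the extended reals: an energy level from which no feasible
  continuation exists has value \<open>-\<infinity>\<close> (the maximum over the empty set), and the terminal value may
  encode a hard final energy requirement in the same way.
\<close>

record 'a ev_model =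
  horizon :: nat
  P_min :: "nat \<Rightarrow> real"
  P_max :: "nat \<Rightarrow> real"
  E_min :: "nat \<Rightarrow> real"
  E_max :: "nat \<Rightarrow> real"
  eff :: real
  deg_cost :: real
  terminal :: "real \<Rightarrow> ereal"
  prob_sp :: "'a measure"
  price :: "nat \<Rightarrow> 'a \<Rightarrow> real"
  price_density :: "nat \<Rightarrow> real \<Rightarrow> real"

definition ev_setting :: "'a ev_model \<Rightarrow> bool" where
  "ev_setting S \<longleftrightarrow>
     prob_space (prob_sp S) \<and>
     0 < eff S \<and> eff S \<le> 1 \<and> 0 \<le> deg_cost S \<and>
     (\<forall>t\<in>{1..horizon S}.
        P_min S t \<le> 0 \<and> 0 \<le> P_max S t \<and> E_min S t \<le> E_max S t \<and>
        (\<forall>x. 0 \<le> price_density S t x) \<and>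
        distributed (prob_sp S) lborel (price S t) (\<lambda>x. ennreal (price_density S t x))) \<and>
     prob_space.indep_vars (prob_sp S) (\<lambda>_. borel) (price S) {1..horizon S}"


subsection \<open>Bellman recursion\<close>

definition next_energy :: "'a ev_model \<Rightarrow> real \<Rightarrow> real \<times> real \<Rightarrow> real" where
  "next_energy S e = (\<lambda>(pc, pd). e + eff S * pc + pd / eff S)"

definition feasible :: "'a ev_model \<Rightarrow> nat \<Rightarrow> real \<Rightarrow> (real \<times> real) set" where
  "feasible S t e = {(pc, pd).
     0 \<le> pc \<and> pc \<le> P_max S t \<and> P_min S t \<le> pd \<and> pd \<le> 0 \<and> pc * pd = 0 \<and>
     E_min S t \<le> next_energy S e (pc, pd) \<and> next_energy S e (pc, pd) \<le> E_max S t}"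

definition stage_reward :: "'a ev_model \<Rightarrow> real \<Rightarrow> real \<times> real \<Rightarrow> real" where
  "stage_reward S p = (\<lambda>(pc, pd). - (p * (pc + pd) - deg_cost S * pd))"

text \<open>\<open>W\<close> is the post-decision value function and \<open>p\<close> the realised price.\<close>

definition bellman :: "'a ev_model \<Rightarrow> nat \<Rightarrow> (real \<Rightarrow> ereal) \<Rightarrow> real \<Rightarrow> real \<Rightarrow> ereal" where
  "bellman S t W p e =
     (SUP a\<in>feasible S t e. ereal (stage_reward S p a) + W (next_energy S e a))"

definition ereal_expectation :: "'a measure \<Rightarrow> ('a \<Rightarrow> ereal) \<Rightarrow> ereal" where
  "ereal_expectation M X =
     enn2ereal (\<integral>\<^sup>+\<omega>. e2ennreal (X \<omega>) \<partial>M) - enn2ereal (\<integral>\<^sup>+\<omega>. e2ennreal (- X \<omega>) \<partial>M)"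

text \<open>Backward recursion on the number \<open>k\<close> of stages still to come after the current one.\<close>

primrec post_value_to_go :: "'a ev_model \<Rightarrow> nat \<Rightarrow> real \<Rightarrow> ereal" where
  "post_value_to_go S 0 = terminal S"
| "post_value_to_go S (Suc k) = (\<lambda>e. ereal_expectation (prob_sp S)
     (\<lambda>\<omega>. bellman S (horizon S - k) (post_value_to_go S k) (price S (horizon S - k) \<omega>) e))"

definition post_value :: "'a ev_model \<Rightarrow> nat \<Rightarrow> real \<Rightarrow> ereal" where
  "post_value S t = post_value_to_go S (horizon S - t)"

definition value_fun :: "'a ev_model \<Rightarrow> nat \<Rightarrow> 'a \<Rightarrow> real \<Rightarrow> ereal" where
  "value_fun S t \<omega> e = bellman S t (post_value S t) (price S t \<omega>) e"

lemma post_value_horizon: "post_value S (horizon S) = terminal S"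
  by (simp add: post_value_def)

lemma post_value_step:
  assumes "t < horizon S"
  shows "post_value S t e = ereal_expectation (prob_sp S) (\<lambda>\<omega>. value_fun S (Suc t) \<omega> e)"
proof -
  have "horizon S - t = Suc (horizon S - Suc t)" and "horizon S - (horizon S - Suc t) = Suc t"
    using assms by auto
  then show ?thesis
    by (simp add: post_value_def value_fun_def)
qed


subsection \<open>Marginal values\<close>

definition eff_domain :: "(real \<Rightarrow> ereal) \<Rightarrow> real set" where
  "eff_domain f = {x. f x \<noteq> -\<infinity>}"

definition ereal_concave :: "(real \<Rightarrow> ereal) \<Rightarrow> bool" where
  "ereal_concave f \<longleftrightarrow> (\<forall>x. f x \<noteq> \<infinity>) \<and> concave_on (eff_domain f) (\<lambda>x. real_of_ereal (f x))"

text \<open>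
  The derivative of a function on an interval of energy levels. Beyond the right end of the
  interval it is \<open>-\<infinity>\<close> and before the left end it is \<open>\<infinity>\<close>, as for the supergradient of a concave
  function. It is well-defined at interior points where the function is differentiable and at
  points away from the closure of the interval, but not at the end points.
\<close>

definition marginal :: "(real \<Rightarrow> ereal) \<Rightarrow> real \<Rightarrow> ereal" where
  "marginal f x =
     (if \<bar>f x\<bar> \<noteq> \<infinity> then ereal (deriv (\<lambda>y. real_of_ereal (f y)) x)
      else if \<forall>y\<in>eff_domain f. y < x then -\<infinity> else \<infinity>)"

definition marginal_defined :: "(real \<Rightarrow> ereal) \<Rightarrow> real \<Rightarrow> bool" where
  "marginal_defined f x \<longleftrightarrow>
     (\<forall>\<^sub>F y in nhds x. \<bar>f y\<bar> \<noteq> \<infinity>) \<and> (\<lambda>y. real_of_ereal (f y)) differentiable (at x)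
     \<or> x \<notin> closure (eff_domain f)"

text \<open>
  The post-decision value as seen by the decision at stage \<open>t\<close>: post-decision energies violating
  the energy bounds of stage \<open>t\<close> are not available.
\<close>

definition admissible_post_value :: "'a ev_model \<Rightarrow> nat \<Rightarrow> real \<Rightarrow> ereal" where
  "admissible_post_value S t e = (if E_min S t \<le> e \<and> e \<le> E_max S t then post_value S t e else -\<infinity>)"

definition v_post :: "'a ev_model \<Rightarrow> nat \<Rightarrow> real \<Rightarrow> ereal" where
  "v_post S t = marginal (admissible_post_value S t)"

definition v_stage :: "'a ev_model \<Rightarrow> nat \<Rightarrow> real \<Rightarrow> 'a \<Rightarrow> ereal" where
  "v_stage S t e \<omega> = marginal (value_fun S t \<omega>) e"


subsection \<open>Price distribution function\<close>

text \<open>The cumulative distribution function, with values 0 at \<open>-\<infinity>\<close> and 1 at \<open>\<infinity>\<close>.\<close>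

definition price_cdf :: "'a ev_model \<Rightarrow> nat \<Rightarrow> ereal \<Rightarrow> real" where
  "price_cdf S t y = measure (distr (prob_sp S) borel (price S t)) {x. ereal x \<le> y}"

lemma price_cdf_ereal: "price_cdf S t (ereal x) = cdf (distr (prob_sp S) borel (price S t)) x"
  by (simp add: price_cdf_def cdf_def atMost_def)

end

(*
  Charging moves the energy level at marginal cost p / eff and discharging at marginal revenue
  (p - deg_cost) * eff. So V_t is the larger of two suprema of the concave post-decision value,
  tilted by a linear function, over a window [e, e + eff * P_max] or [e + P_min / eff, e] that
  moves with e. A tilted concave function is quasiconcave. If the marginal value at a window end
  exceeds (or falls below) the slope, it is monotone up to and slightly beyond that end, hence the
  supremum locally sits at an end point or is a global supremum that does not depend on e.
  The marginal value v_t is therefore a, p / eff, b, (p - deg_cost) * eff or c, according to the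
  position of the price p relative to eff * a, eff * b, b / eff + deg_cost and c / eff + deg_cost.
  When b < 0, there can be prices at which both charging and discharging are profitable. The mass
  hypothesis makes these a null set, but v_t still has to be measurable there.
*)
theory Submission
  imports Defs
begin

subsection \<open>Tilted concave functions and marginal values\<close>

definition tilt :: "(real \<Rightarrow> ereal) \<Rightarrow> real \<Rightarrow> real \<Rightarrow> ereal" where
  "tilt G m x = G x + ereal (- m * x)"

lemma tilt_eq_ereal: "G x = ereal r \<Longrightarrow> tilt G m x = ereal (r - m * x)"
  by (simp add: tilt_def)

lemma tilt_eq_MInf_iff [simp]: "tilt G m x = -\<infinity> \<longleftrightarrow> G x = -\<infinity>"
  by (cases "G x") (auto simp: tilt_def)

lemma ereal_concave_ereal:
  assumes "ereal_concave G" "x \<in> eff_domain G"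
  shows "G x = ereal (real_of_ereal (G x))"
  using assms by (cases "G x") (auto simp: ereal_concave_def eff_domain_def)

lemma ereal_concave_convex_domain:
  "ereal_concave G \<Longrightarrow> convex (eff_domain G)"
  by (auto simp: ereal_concave_def dest: concave_on_imp_convex)

lemma eff_domain_between:
  assumes "ereal_concave G" "x \<in> eff_domain G" "z \<in> eff_domain G" "x \<le> y" "y \<le> z"
  shows "y \<in> eff_domain G"
  using ereal_concave_convex_domain[OF assms(1)] assms(2-)
  by (metis is_interval_1 is_interval_convex_1)

text \<open>Inside the domain the tilt is concave and lies above a weighted average of its end
  values; otherwise one end value is \<open>-\<infinity>\<close>. Quasiconcavity is used because it
  involves no sums of extended reals.\<close>

lemma tilt_quasiconcave:
  assumes G: "ereal_concave G" and "x \<le> y" "y \<le> z"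
  shows "min (tilt G m x) (tilt G m z) \<le> tilt G m y"
proof (cases "x \<in> eff_domain G \<and> z \<in> eff_domain G")
  case False
  then show ?thesis
    by (auto simp: tilt_def eff_domain_def)
next
  case True
  define g where "g = (\<lambda>x. real_of_ereal (G x))"
  have y: "y \<in> eff_domain G"
    using eff_domain_between[OF G] True assms by blast
  have gx: "G x = ereal (g x)" "G y = ereal (g y)" "G z = ereal (g z)"
    using ereal_concave_ereal[OF G] True y by (auto simp: g_def)
  have conc: "concave_on (eff_domain G) g"
    using G by (simp add: ereal_concave_def g_def)
  have "y \<in> closed_segment x z"
    using assms by (simp add: closed_segment_eq_real_ivl1)
  then obtain s where s: "0 \<le> s" "s \<le> 1" "y = (1 - s) * x + s * z"
    by (auto simp: closed_segment_def)
  have "(1 - s) * g x + s * g z \<le> g y"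
    using concave_onD[OF conc, of s x z] True s by simp
  then have *: "(1 - s) * (g x - m * x) + s * (g z - m * z) \<le> g y - m * y"
    by (simp add: s(3) algebra_simps)
  have "min (g x - m * x) (g z - m * z)
      = (1 - s) * min (g x - m * x) (g z - m * z) + s * min (g x - m * x) (g z - m * z)"
    by (simp add: algebra_simps)
  also have "\<dots> \<le> (1 - s) * (g x - m * x) + s * (g z - m * z)"
    using s by (intro add_mono mult_left_mono) auto
  finally have "min (g x - m * x) (g z - m * z) \<le> g y - m * y"
    using * by linarith
  then show ?thesis
    by (auto simp: gx tilt_eq_ereal min_def split: if_splits)
qed

section \<open>Quasiconcave functions on the line\<close>

lemma quasiconcave_increasing_left:
  fixes H :: "real \<Rightarrow> 'b::linorder"
  assumes qc: "\<And>x y z. x \<le> y \<Longrightarrow> y \<le> z \<Longrightarrow> min (H x) (H z) \<le> H y"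
    and "p < q" "H p < H q" "x \<le> x'" "x' \<le> p"
  shows "H x \<le> H x'"
proof (rule ccontr)
  assume "\<not> H x \<le> H x'"
  \<comment> \<open>A drop from \<open>x\<close> to \<open>x'\<close> leaves only
    \<open>H q \<le> H x'\<close>; the triple \<open>x'\<close>, \<open>p\<close>, \<open>q\<close>
    then forces \<open>H q \<le> H p\<close>, against the strict rise.\<close>
  then have "H q \<le> H x'"
    using qc[of x x' q] assms by (auto simp: min_le_iff_disj)
  then show False
    using qc[of x' p q] assms \<open>\<not> H x \<le> H x'\<close>
    by (auto simp: min_le_iff_disj not_le)
qed

lemma quasiconcave_decreasing_right:
  fixes H :: "real \<Rightarrow> 'b::linorder"
  assumes qc: "\<And>x y z. x \<le> y \<Longrightarrow> y \<le> z \<Longrightarrow> min (H x) (H z) \<le> H y"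
    and "q < p" "H p < H q" "p \<le> x'" "x' \<le> x"
  shows "H x \<le> H x'"
proof -
  have "min (H (- u)) (H (- w)) \<le> H (- v)" if "u \<le> v" "v \<le> w" for u v w
    using qc[of "- w" "- v" "- u"] that by (simp add: min.commute)
  from quasiconcave_increasing_left[of "\<lambda>y. H (- y)" "- p" "- q" "- x" "- x'", OF this]
  show ?thesis
    using assms by simp
qed

section \<open>Marginal values and local behaviour\<close>

lemma marginal_definedE:
  assumes "marginal_defined f x"
  obtains (smooth) g d where "\<forall>\<^sub>F y in nhds x. f y = ereal (g y)" "(g has_real_derivative d) (at x)"
      "marginal f x = ereal d"
    | (outside) "x \<notin> closure (eff_domain f)" "\<forall>\<^sub>F y in nhds x. f y = -\<infinity>"
      "marginal f x = (if \<forall>y\<in>eff_domain f. y < x then -\<infinity> else \<infinity>)"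
  using assms unfolding marginal_defined_def
proof (elim disjE conjE)
  assume ev: "\<forall>\<^sub>F y in nhds x. \<bar>f y\<bar> \<noteq> \<infinity>"
    and d: "(\<lambda>y. real_of_ereal (f y)) differentiable at x"
  show thesis
  proof (rule smooth)
    show "\<forall>\<^sub>F y in nhds x. f y = ereal (real_of_ereal (f y))"
      using ev by eventually_elim (auto simp: ereal_real)
    show "((\<lambda>y. real_of_ereal (f y)) has_real_derivative deriv (\<lambda>y. real_of_ereal (f y)) x) (at x)"
      using d by (simp add: DERIV_deriv_iff_real_differentiable)
    show "marginal f x = ereal (deriv (\<lambda>y. real_of_ereal (f y)) x)"
      using eventually_nhds_x_imp_x[OF ev] by (simp add: marginal_def)
  qed
next
  assume x: "x \<notin> closure (eff_domain f)"
  show thesis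
  proof (rule outside[OF x])
    have "\<forall>\<^sub>F y in nhds x. y \<in> - closure (eff_domain f)"
      using x by (intro eventually_nhds_in_open) auto
    then show "\<forall>\<^sub>F y in nhds x. f y = -\<infinity>"
    proof eventually_elim
      case (elim y)
      then have "y \<notin> eff_domain f"
        using closure_subset by blast
      then show ?case
        by (simp add: eff_domain_def)
    qed
    then have "f x = -\<infinity>"
      by (rule eventually_nhds_x_imp_x)
    then show "marginal f x = (if \<forall>y\<in>eff_domain f. y < x then -\<infinity> else \<infinity>)"
      by (simp add: marginal_def)
  qed
qed

lemma marginal_smooth:
  assumes "\<forall>\<^sub>F y in nhds x. f y = ereal (g y)" "(g has_real_derivative d) (at x)"
  shows "marginal_defined f x" "marginal f x = ereal d"
proof -
  have ev: "\<forall>\<^sub>F y in nhds x. real_of_ereal (f y) = g y"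
    using assms(1) by eventually_elim simp
  have D: "((\<lambda>y. real_of_ereal (f y)) has_real_derivative d) (at x)"
    using DERIV_cong_ev[OF refl ev refl] assms(2) by blast
  have fin: "\<forall>\<^sub>F y in nhds x. \<bar>f y\<bar> \<noteq> \<infinity>"
    using assms(1) by eventually_elim simp
  show "marginal_defined f x"
    using fin D unfolding marginal_defined_def
    by (metis real_differentiable_def)
  show "marginal f x = ereal d"
    using eventually_nhds_x_imp_x[OF fin] DERIV_imp_deriv[OF D] by (simp add: marginal_def)
qed

lemma marginal_outside:
  assumes "\<forall>\<^sub>F y in nhds x. f y = -\<infinity>"
  shows "marginal_defined f x"
    "marginal f x = (if \<forall>y\<in>eff_domain f. y < x then -\<infinity> else \<infinity>)"
proof -
  obtain U where U: "open U" "x \<in> U" "\<And>y. y \<in> U \<Longrightarrow> f y = -\<infinity>"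
    using assms unfolding eventually_nhds by blast
  have "x \<notin> closure (eff_domain f)"
    using U by (auto simp: closure_iff_nhds_not_empty eff_domain_def)
  then show "marginal_defined f x"
    by (simp add: marginal_defined_def)
  show "marginal f x = (if \<forall>y\<in>eff_domain f. y < x then -\<infinity> else \<infinity>)"
    using eventually_nhds_x_imp_x[OF assms] by (simp add: marginal_def)
qed

lemma outside_domain_cases:
  assumes G: "ereal_concave G" and x: "x \<notin> eff_domain G"
  shows "(\<forall>y\<in>eff_domain G. y < x) \<or> (\<forall>y\<in>eff_domain G. x < y)"
  using eff_domain_between[OF G] x by (metis linorder_le_less_linear)

lemma has_real_derivative_tilt:
  "(g has_real_derivative d) (at x) \<Longrightarrow> ((\<lambda>y. g y - m * y) has_real_derivative d - m) (at x)"
  by (auto intro!: derivative_eq_intros)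

text \<open>Monotonicity has to reach beyond \<open>z\<close> to cover windows that end slightly to
  its right. The derivative yields \<open>q > z\<close> with a strictly larger tilt, continuity
  carries this strict inequality to some \<open>w\<close> between them, and quasiconcavity does the
  rest. Outside the closure of the domain the marginal value must be \<open>\<infinity>\<close>, so
  the tilt is \<open>-\<infinity>\<close> until past \<open>z\<close>.\<close>

lemma less_marginal_tilt_increasing:
  assumes G: "ereal_concave G" and z: "marginal_defined G z" "ereal m < marginal G z"
  shows "\<exists>w>z. \<forall>x x'. x \<le> x' \<longrightarrow> x' \<le> w \<longrightarrow> tilt G m x \<le> tilt G m x'"
  using z(1)
proof (cases rule: marginal_definedE)
  case (smooth g d)
  define h where "h = (\<lambda>y. g y - m * y)"
  have D: "(h has_real_derivative d - m) (at z)"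
    unfolding h_def using smooth(2) by (rule has_real_derivative_tilt)
  have "0 < d - m"
    using z(2) smooth(3) by simp
  from DERIV_pos_inc_right[OF D this] obtain r where
    r: "0 < r" "\<And>k. 0 < k \<Longrightarrow> k < r \<Longrightarrow> h z < h (z + k)"
    by auto
  obtain r' where r': "0 < r'" "\<And>y. dist y z < r' \<Longrightarrow> G y = ereal (g y)"
    using smooth(1) unfolding eventually_nhds_metric by blast
  define q where "q = z + min r r' / 2"
  have q: "z < q" "h z < h q" "G q = ereal (g q)"
    using r(1) r'(1) r(2)[of "min r r' / 2"] r'(2)[of q] by (auto simp: q_def dist_real_def)
  have "isCont h z"
    using D by (rule DERIV_isCont)
  then have "\<forall>\<^sub>F y in at z. h y < h q"
    unfolding isCont_def using q(2) by (rule order_tendstoD)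
  then obtain r'' where r'': "0 < r''" "\<And>y. y \<noteq> z \<Longrightarrow> dist y z < r'' \<Longrightarrow> h y < h q"
    unfolding eventually_at by blast
  define w where "w = z + min (min r' r'') (q - z) / 2"
  have "z < w" "w < q" "w - z < r'" "w - z < r''"
    using r'(1) r''(1) q(1) by (simp_all add: w_def field_simps min_def)
  then have w: "z < w" "w < q" "h w < h q" "G w = ereal (g w)"
    using r''(2)[of w] r'(2)[of w] by (auto simp: dist_real_def)
  have "tilt G m w < tilt G m q"
    using w q by (simp add: tilt_eq_ereal h_def)
  then show ?thesis
    using quasiconcave_increasing_left[of "tilt G m" w q] tilt_quasiconcave[OF G] w by blast
next
  case outside
  have zn: "z \<notin> eff_domain G"
    using outside(1) closure_subset by blast
  have right: "\<forall>y\<in>eff_domain G. z < y"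
    using outside_domain_cases[OF G zn] z(2) outside(3) by (auto split: if_splits)
  obtain r where r: "0 < r" "\<And>y. dist y z < r \<Longrightarrow> G y = -\<infinity>"
    using outside(2) unfolding eventually_nhds_metric by blast
  have "G x = -\<infinity>" if "x \<le> z + r / 2" for x
    using right r that by (cases "x \<le> z") (force simp: eff_domain_def dist_real_def)+
  then show ?thesis
    using r(1) by (intro exI[of _ "z + r / 2"]) (auto simp: tilt_def)
qed

lemma marginal_less_tilt_decreasing:
  assumes G: "ereal_concave G" and z: "marginal_defined G z" "marginal G z < ereal m"
  shows "\<exists>w<z. \<forall>x x'. w \<le> x' \<longrightarrow> x' \<le> x \<longrightarrow> tilt G m x \<le> tilt G m x'"
  using z(1)
proof (cases rule: marginal_definedE)
  case (smooth g d)
  define h where "h = (\<lambda>y. g y - m * y)"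
  have D: "(h has_real_derivative d - m) (at z)"
    unfolding h_def using smooth(2) by (rule has_real_derivative_tilt)
  have "d - m < 0"
    using z(2) smooth(3) by simp
  from DERIV_neg_dec_left[OF D this] obtain r where
    r: "0 < r" "\<And>k. 0 < k \<Longrightarrow> k < r \<Longrightarrow> h z < h (z - k)"
    by auto
  obtain r' where r': "0 < r'" "\<And>y. dist y z < r' \<Longrightarrow> G y = ereal (g y)"
    using smooth(1) unfolding eventually_nhds_metric by blast
  define q where "q = z - min r r' / 2"
  have q: "q < z" "h z < h q" "G q = ereal (g q)"
    using r(1) r'(1) r(2)[of "min r r' / 2"] r'(2)[of q] by (auto simp: q_def dist_real_def)
  have "isCont h z"
    using D by (rule DERIV_isCont)
  then have "\<forall>\<^sub>F y in at z. h y < h q"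
    unfolding isCont_def using q(2) by (rule order_tendstoD)
  then obtain r'' where r'': "0 < r''" "\<And>y. y \<noteq> z \<Longrightarrow> dist y z < r'' \<Longrightarrow> h y < h q"
    unfolding eventually_at by blast
  define w where "w = z - min (min r' r'') (z - q) / 2"
  have "w < z" "q < w" "z - w < r'" "z - w < r''"
    using r'(1) r''(1) q(1) by (simp_all add: w_def field_simps min_def)
  then have w: "w < z" "q < w" "h w < h q" "G w = ereal (g w)"
    using r''(2)[of w] r'(2)[of w] by (auto simp: dist_real_def)
  have "tilt G m w < tilt G m q"
    using w q by (simp add: tilt_eq_ereal h_def)
  then show ?thesis
    using quasiconcave_decreasing_right[of "tilt G m" q w] tilt_quasiconcave[OF G] w by blast
next
  case outside
  have left: "\<forall>y\<in>eff_domain G. y < z"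
    using z(2) outside(3) by (auto split: if_splits)
  obtain r where r: "0 < r" "\<And>y. dist y z < r \<Longrightarrow> G y = -\<infinity>"
    using outside(2) unfolding eventually_nhds_metric by blast
  have "G x = -\<infinity>" if "z - r / 2 \<le> x" for x
    using left r that by (cases "z \<le> x") (force simp: eff_domain_def dist_real_def)+
  then show ?thesis
    using r(1) by (intro exI[of _ "z - r / 2"]) (auto simp: tilt_def)
qed

text \<open>If the marginal value rose from \<open>x\<close> to \<open>y\<close>, every slope
  strictly between would make the tilt both nonincreasing and nondecreasing, hence constant, around
  \<open>[x, y]\<close>. Two such slopes contradict each other.\<close>

lemma marginal_antimono:
  assumes G: "ereal_concave G" and def: "marginal_defined G x" "marginal_defined G y"
    and "x \<le> y"
  shows "marginal G y \<le> marginal G x"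
proof (rule ccontr)
  assume "\<not> marginal G y \<le> marginal G x"
  then obtain m where m: "marginal G x < ereal m" "ereal m < marginal G y"
    using ereal_dense2 by (metis linorder_not_le)
  \<comment> \<open>Constancy for one slope only makes \<open>G\<close> affine there; a second slope
    gives the contradiction.\<close>
  obtain m' where m': "marginal G x < ereal m'" "ereal m' < ereal m"
    using ereal_dense2[OF m(1)] by blast
  have const: "\<exists>w<x. \<exists>w'>y. \<forall>u v. w \<le> u \<longrightarrow> u \<le> v \<longrightarrow> v \<le> w' \<longrightarrow> tilt G k u = tilt G k v"
    if k: "marginal G x < ereal k" "ereal k < marginal G y" for k
  proof -
    obtain w' where w': "w' > y" "\<And>u v. u \<le> v \<Longrightarrow> v \<le> w' \<Longrightarrow> tilt G k u \<le> tilt G k v"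
      using less_marginal_tilt_increasing[OF G def(2) k(2)] by blast
    obtain w where w: "w < x" "\<And>u v. w \<le> u \<Longrightarrow> u \<le> v \<Longrightarrow> tilt G k v \<le> tilt G k u"
      using marginal_less_tilt_decreasing[OF G def(1) k(1)] by blast
    show ?thesis
      using w w' by (meson order_antisym)
  qed
  have const': "\<exists>w>y. \<forall>u. x \<le> u \<longrightarrow> u \<le> w \<longrightarrow> tilt G k x = tilt G k u"
    if "marginal G x < ereal k" "ereal k < marginal G y" for k
    using const[OF that] by (meson less_imp_le)
  obtain w1 where w1: "w1 > y" "\<And>u. x \<le> u \<Longrightarrow> u \<le> w1 \<Longrightarrow> tilt G m x = tilt G m u"
    using const'[OF m] by blast
  obtain w2 where w2: "w2 > y" "\<And>u. x \<le> u \<Longrightarrow> u \<le> w2 \<Longrightarrow> tilt G m' x = tilt G m' u"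
    using const'[OF m'(1) less_trans[OF m'(2) m(2)]] by blast
  \<comment> \<open>\<open>u\<close> lies strictly beyond \<open>y\<close>, so \<open>x < u\<close>
    even if \<open>x = y\<close>.\<close>
  define u where "u = min w1 w2"
  have u: "x < u" "tilt G m x = tilt G m u" "tilt G m' x = tilt G m' u"
    using w1(1) w2(1) \<open>x \<le> y\<close> by (auto simp: u_def intro!: w1(2) w2(2))
  show False
  proof (cases "x \<in> eff_domain G")
    case True
    then have "G u \<noteq> -\<infinity>"
      using u(2) tilt_eq_MInf_iff[of G m x] tilt_eq_MInf_iff[of G m u] by (simp add: eff_domain_def)
    then obtain p q where "G x = ereal p" "G u = ereal q"
      using ereal_concave_ereal[OF G, of x] ereal_concave_ereal[OF G, of u] True
      by (auto simp: eff_domain_def)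
    then have "p - m * x = q - m * u" "p - m' * x = q - m' * u"
      using u(2,3) by (simp_all add: tilt_eq_ereal)
    then have "(m - m') * (u - x) = 0"
      by (simp add: algebra_simps)
    then show False
      using u(1) m'(2) by simp
  next
    case False
    then have Gx: "G x = -\<infinity>"
      by (simp add: eff_domain_def)
    \<comment> \<open>A marginal value below \<open>m\<close> is not \<open>\<infinity>\<close>, so
      the domain lies left of \<open>x\<close> and hence of \<open>y\<close>; the marginal value at
      \<open>y\<close> would then be \<open>-\<infinity>\<close>.\<close>
    have left: "\<forall>v\<in>eff_domain G. v < x"
      using def(1)
    proof (cases rule: marginal_definedE)
      case (smooth g d)
      then show ?thesis
        using eventually_nhds_x_imp_x[OF smooth(1)] Gx by simp
    next
      case outside
      then show ?thesis
        using m(1) by (auto split: if_splits)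
    qed
    show False
      using def(2)
    proof (cases rule: marginal_definedE)
      case (smooth g d)
      then have "y \<in> eff_domain G"
        using eventually_nhds_x_imp_x[OF smooth(1)] by (simp add: eff_domain_def)
      then show False
        using left \<open>x \<le> y\<close> by force
    next
      case outside
      then show False
        using m(2) left \<open>x \<le> y\<close> by (auto split: if_splits)
    qed
  qed
qed

text \<open>A concave function lies below an affine one, which is bounded on a bounded set. This
  keeps the global supremum of a tilt below \<open>\<infinity>\<close>.\<close>

lemma tilt_bounded_above:
  assumes G: "ereal_concave G" and bdd: "bounded (eff_domain G)"
  shows "\<exists>M. \<forall>x. tilt G m x \<le> ereal M"
proof -
  define D where "D = eff_domain G"
  define f where "f = (\<lambda>x. - real_of_ereal (G x))"
  have conv: "convex_on D f"
    using G by (simp add: ereal_concave_def concave_on_def D_def f_def)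
  obtain B where B: "\<And>x. x \<in> D \<Longrightarrow> \<bar>x\<bar> \<le> B"
    using bdd by (auto simp: bounded_iff D_def)
  have "\<exists>C k. \<forall>x\<in>D. C + k * x \<le> f x"
  proof (cases "interior D = {}")
    case True
    have "x = y" if "x \<in> D" "y \<in> D" for x y
    proof (rule ccontr)
      assume "x \<noteq> y"
      have "{min x y<..<max x y} \<subseteq> D"
        using eff_domain_between[OF G, of "min x y" "max x y"] that by (auto simp: D_def min_def max_def)
      then have "{min x y<..<max x y} \<subseteq> interior D"
        by (rule interior_maximal) simp
      then show False
        using True \<open>x \<noteq> y\<close> by auto
    qed
    then have "D = {} \<or> (\<exists>x. D = {x})"
      by blast
    then show ?thesis
      by (metis add.right_neutral empty_iff mult_zero_left order_refl singletonD)
  next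
    case False
    then obtain x0 where x0: "x0 \<in> interior D"
      by blast
    \<comment> \<open>Slope of a supporting line of the convex function \<open>f\<close> at the
      interior point \<open>x0\<close>: the infimum of the difference quotients to its
      right.\<close>
    define k where "k = Inf ((\<lambda>t. (f x0 - f t) / (x0 - t)) ` ({x0<..} \<inter> D))"
    have "(f x0 - k * x0) + k * x \<le> f x" if "x \<in> D" for x
      using convex_le_Inf_differential[OF conv x0 that] by (simp add: k_def algebra_simps)
    then show ?thesis
      by blast
  qed
  then obtain C k where Ck: "\<And>x. x \<in> D \<Longrightarrow> C + k * x \<le> f x"
    by blast
  have "tilt G m x \<le> ereal (\<bar>C\<bar> + \<bar>k + m\<bar> * B)" for x
  proof (cases "x \<in> D")
    case True
    have "- ((k + m) * x) \<le> \<bar>k + m\<bar> * \<bar>x\<bar>"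
      by (metis abs_ge_minus_self abs_mult)
    also have "\<dots> \<le> \<bar>k + m\<bar> * B"
      using B[OF True] by (intro mult_left_mono) auto
    finally have "- f x - m * x \<le> \<bar>C\<bar> + \<bar>k + m\<bar> * B"
      using Ck[OF True] by (simp add: algebra_simps)
    moreover have "G x = ereal (- f x)"
      using ereal_concave_ereal[OF G] True by (simp add: D_def f_def)
    ultimately show ?thesis
      by (simp add: tilt_eq_ereal)
  next
    case False
    then show ?thesis
      by (simp add: D_def eff_domain_def tilt_def)
  qed
  then show ?thesis
    by blast
qed

subsection \<open>Suprema over a moving window\<close>

text \<open>Energy moves from \<open>y\<close> to \<open>x\<close> by an amount in
  \<open>[l, u]\<close>, at price \<open>m\<close> per unit gained; a negative \<open>x - y\<close>
  is a sale.\<close>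

definition window_value :: "(real \<Rightarrow> ereal) \<Rightarrow> real \<Rightarrow> real \<Rightarrow> real \<Rightarrow> real \<Rightarrow> ereal" where
  "window_value G m l u y = (SUP x\<in>{y + l..y + u}. G x + ereal (- m * (x - y)))"

lemma eventually_nhds_real_between:
  fixes x :: real
  assumes "p < x" "x < q"
  shows "\<forall>\<^sub>F y in nhds x. p < y \<and> y < q"
  using eventually_nhds_in_open[of "{p<..<q}" x] assms by simp

lemma window_value_ge:
  assumes "y + l \<le> x" "x \<le> y + u"
  shows "G x + ereal (- m * (x - y)) \<le> window_value G m l u y"
  unfolding window_value_def using assms by (intro SUP_upper) auto

lemma window_value_ge_self:
  assumes "l \<le> 0" "0 \<le> u"
  shows "G y \<le> window_value G m l u y"
  using window_value_ge[of y l y u G m] assms by (simp flip: zero_ereal_def)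

text \<open>Decouples \<open>x\<close> from \<open>y\<close>: apart from the additive term
  \<open>m * y\<close>, the level \<open>y\<close> only moves the window.\<close>

lemma window_value_tilt:
  "G x + ereal (- m * (x - y)) = tilt G m x + ereal (m * y)"
  by (cases "G x") (simp_all add: tilt_def algebra_simps)

lemma window_value_eqI:
  assumes "y + l \<le> x" "x \<le> y + u"
    and "\<And>x'. y + l \<le> x' \<Longrightarrow> x' \<le> y + u \<Longrightarrow> tilt G m x' \<le> tilt G m x"
  shows "window_value G m l u y = G x + ereal (- m * (x - y))"
  unfolding window_value_def window_value_tilt
  using assms by (intro SUP_eqI) (auto intro!: add_right_mono)

lemma eff_domain_window_value:
  "y \<in> eff_domain (window_value G m l u) \<longleftrightarrow> (\<exists>x\<in>eff_domain G. y + l \<le> x \<and> x \<le> y + u)"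
proof -
  have "window_value G m l u y = -\<infinity> \<longleftrightarrow> (\<forall>x\<in>{y + l..y + u}. G x = -\<infinity>)"
    unfolding window_value_def bot_ereal_def[symmetric] SUP_bot_conv
    by (rule ball_cong) (auto simp: bot_ereal_def)
  then show ?thesis
    by (auto simp: eff_domain_def)
qed

text \<open>A finite marginal value is local, but an infinite one depends on the side on which the
  whole domain lies. The hypotheses \<open>right\<close> and \<open>left\<close> transfer that side
  from \<open>G\<close> to \<open>f\<close>.\<close>

lemma marginal_shift:
  assumes eq: "\<forall>\<^sub>F y in nhds e. f y = G (y + s) + ereal k"
    and G: "marginal_defined G (e + s)"
    and right: "marginal G (e + s) = \<infinity> \<Longrightarrow> \<exists>y\<in>eff_domain f. e \<le> y"
    and left: "marginal G (e + s) = -\<infinity> \<Longrightarrow> \<forall>y\<in>eff_domain f. y < e"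
  shows "marginal_defined f e" "marginal f e = marginal G (e + s)"
proof -
  have lim: "filterlim (\<lambda>y. y + s) (nhds (e + s)) (nhds e)"
    by (intro tendsto_intros filterlim_ident)
  have "marginal_defined f e \<and> marginal f e = marginal G (e + s)"
    using G
  proof (cases rule: marginal_definedE)
    case (smooth g d)
    have "\<forall>\<^sub>F y in nhds e. G (y + s) = ereal (g (y + s))"
      using smooth(1) lim by (rule eventually_compose_filterlim)
    with eq have ev: "\<forall>\<^sub>F y in nhds e. f y = ereal (g (y + s) + k)"
      by eventually_elim simp
    have D: "((\<lambda>y. g (y + s) + k) has_real_derivative d) (at e)"
      using smooth(2) by (auto intro!: derivative_eq_intros simp: DERIV_shift)
    show ?thesis
      using marginal_smooth[OF ev D] smooth(3) by simp
  next
    case outside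
    have "\<forall>\<^sub>F y in nhds e. G (y + s) = -\<infinity>"
      using outside(2) lim by (rule eventually_compose_filterlim)
    with eq have ev: "\<forall>\<^sub>F y in nhds e. f y = -\<infinity>"
      by eventually_elim simp
    show ?thesis
      using marginal_outside[OF ev] outside(3) left right by (force split: if_splits)
  qed
  then show "marginal_defined f e" "marginal f e = marginal G (e + s)"
    by auto
qed

text \<open>When the marginal value at the right end exceeds the slope, the tilt increases until
  slightly beyond that end, so every window near the one at \<open>e\<close> is optimal at its right
  end.\<close>

lemma window_value_eq_right:
  assumes G: "ereal_concave G" and z: "marginal_defined G (e + u)" "ereal m < marginal G (e + u)"
    and "l \<le> u"
  shows "\<forall>\<^sub>F y in nhds e. window_value G m l u y = G (y + u) + ereal (- m * u)"
proof -
  obtain w where w: "e + u < w" "\<And>x x'. x \<le> x' \<Longrightarrow> x' \<le> w \<Longrightarrow> tilt G m x \<le> tilt G m x'"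
    using less_marginal_tilt_increasing[OF G z] by blast
  have "\<forall>\<^sub>F y in nhds e. e - 1 < y \<and> y < w - u"
    using w(1) by (intro eventually_nhds_real_between) auto
  then show ?thesis
  proof eventually_elim
    case (elim y)
    then show ?case
      using window_value_eqI[of y l "y + u" u G m] w(2) \<open>l \<le> u\<close> by simp
  qed
qed

lemma window_value_eq_left:
  assumes G: "ereal_concave G" and z: "marginal_defined G (e + l)" "marginal G (e + l) < ereal m"
    and "l \<le> u"
  shows "\<forall>\<^sub>F y in nhds e. window_value G m l u y = G (y + l) + ereal (- m * l)"
proof -
  obtain w where w: "w < e + l" "\<And>x x'. w \<le> x' \<Longrightarrow> x' \<le> x \<Longrightarrow> tilt G m x \<le> tilt G m x'"
    using marginal_less_tilt_decreasing[OF G z] by blast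
  have "\<forall>\<^sub>F y in nhds e. w - l < y \<and> y < e + 1"
    using w(1) by (intro eventually_nhds_real_between) auto
  then show ?thesis
  proof eventually_elim
    case (elim y)
    then show ?case
      using window_value_eqI[of y l "y + l" u G m] w(2) \<open>l \<le> u\<close> by simp
  qed
qed

text \<open>The tilt increases up to the left end and decreases from the right end, for
  \<open>y\<close> near \<open>e\<close> as well, so the window supremum is the global supremum
  \<open>K\<close> and only \<open>m * y\<close> varies. The supremum need not be attained;
  dominating points replace a maximiser.\<close>

lemma window_value_eq_linear:
  assumes G: "ereal_concave G" and bdd: "bounded (eff_domain G)"
    and r: "marginal_defined G (e + u)" "marginal G (e + u) < ereal m"
    and l: "marginal_defined G (e + l)" "ereal m < marginal G (e + l)"
    and "l \<le> u"
  shows "\<exists>k. \<forall>\<^sub>F y in nhds e. window_value G m l u y = ereal (m * y + k)"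
proof -
  obtain w where w: "w < e + u" "\<And>x x'. w \<le> x' \<Longrightarrow> x' \<le> x \<Longrightarrow> tilt G m x \<le> tilt G m x'"
    using marginal_less_tilt_decreasing[OF G r] by blast
  obtain w' where w': "e + l < w'" "\<And>x x'. x \<le> x' \<Longrightarrow> x' \<le> w' \<Longrightarrow> tilt G m x \<le> tilt G m x'"
    using less_marginal_tilt_increasing[OF G l] by blast
  define K where "K = (SUP x. tilt G m x)"
  obtain M where "\<And>x. tilt G m x \<le> ereal M"
    using tilt_bounded_above[OF G bdd] by blast
  then have "K \<le> ereal M"
    unfolding K_def by (intro SUP_least)
  \<comment> \<open>With an empty domain every marginal value would be \<open>-\<infinity>\<close>,
    against the strict lower bound at \<open>e + l\<close>.\<close>
  moreover have "K \<noteq> -\<infinity>"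
  proof
    assume "K = -\<infinity>"
    then have "tilt G m x = -\<infinity>" for x
      unfolding K_def using SUP_upper[of x UNIV "tilt G m"] by simp
    then have Gx: "G x = -\<infinity>" for x
      using tilt_eq_MInf_iff by blast
    then have "marginal G x = -\<infinity>" for x
      by (simp add: marginal_def eff_domain_def)
    then show False
      using l(2) by simp
  qed
  ultimately obtain k where k: "K = ereal k"
    by (cases K) auto
  have "\<forall>\<^sub>F y in nhds e. w - u < y \<and> y < w' - l"
    using w(1) w'(1) by (intro eventually_nhds_real_between) auto
  then have "\<forall>\<^sub>F y in nhds e. window_value G m l u y = ereal (m * y + k)"
  proof eventually_elim
    case (elim y)
    \<comment> \<open>Points left of the window are dominated by its left end, points right of it by
      its right end.\<close>
    have "\<exists>x'\<in>{y + l..y + u}. tilt G m x \<le> tilt G m x'" for x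
    proof -
      consider "x < y + l" | "x \<in> {y + l..y + u}" | "y + u < x"
        by force
      then show ?thesis
      proof cases
        case 1
        then show ?thesis
          using w'(2)[of x "y + l"] elim \<open>l \<le> u\<close> by (intro bexI[of _ "y + l"]) auto
      next
        case 3
        then show ?thesis
          using w(2)[of "y + u" x] elim \<open>l \<le> u\<close> by (intro bexI[of _ "y + u"]) auto
      qed auto
    qed
    then have "(SUP x\<in>{y + l..y + u}. tilt G m x) = K"
      unfolding K_def by (intro antisym SUP_subset_mono SUP_mono) auto
    moreover have "window_value G m l u y = (SUP x\<in>{y + l..y + u}. tilt G m x) + ereal (m * y)"
      unfolding window_value_def window_value_tilt
      using \<open>l \<le> u\<close> by (intro SUP_ereal_add_left) auto
    ultimately show ?case
      by (simp add: k add.commute)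
  qed
  then show ?thesis
    by blast
qed

section \<open>Marginal values of a single window\<close>

lemma window_marginal_right:
  assumes G: "ereal_concave G" and z: "marginal_defined G (e + u)" "ereal m < marginal G (e + u)"
    and "l \<le> u"
  shows "marginal_defined (window_value G m l u) e"
    and "marginal (window_value G m l u) e = marginal G (e + u)"
proof -
  have right: "\<exists>y\<in>eff_domain (window_value G m l u). e \<le> y" if inf: "marginal G (e + u) = \<infinity>"
  proof -
    have "\<exists>x\<in>eff_domain G. e + u \<le> x"
      using z(1) by (cases rule: marginal_definedE) (use inf in \<open>auto simp: not_less split: if_splits\<close>)
    then obtain x where "x \<in> eff_domain G" "e + u \<le> x"
      by blast
    then show ?thesis
      using \<open>l \<le> u\<close> by (intro bexI[of _ "x - u"]) (auto simp: eff_domain_window_value intro!: bexI[of _ x])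
  qed
  have left: "marginal G (e + u) \<noteq> -\<infinity>"
    using z(2) by auto
  show "marginal_defined (window_value G m l u) e"
    "marginal (window_value G m l u) e = marginal G (e + u)"
    using marginal_shift[OF window_value_eq_right[OF assms] z(1)] right left by auto
qed

lemma window_marginal_left:
  assumes G: "ereal_concave G" and z: "marginal_defined G (e + l)" "marginal G (e + l) < ereal m"
    and "l \<le> u"
  shows "marginal_defined (window_value G m l u) e"
    and "marginal (window_value G m l u) e = marginal G (e + l)"
proof -
  have left: "\<forall>y\<in>eff_domain (window_value G m l u). y < e" if inf: "marginal G (e + l) = -\<infinity>"
  proof -
    have "\<forall>x\<in>eff_domain G. x < e + l"
      using z(1) by (cases rule: marginal_definedE) (use inf in \<open>auto split: if_splits\<close>)
    then show ?thesis
      by (force simp: eff_domain_window_value)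
  qed
  have right: "marginal G (e + l) \<noteq> \<infinity>"
    using z(2) by auto
  show "marginal_defined (window_value G m l u) e"
    "marginal (window_value G m l u) e = marginal G (e + l)"
    using marginal_shift[OF window_value_eq_left[OF assms] z(1)] right left by auto
qed

lemma window_marginal_linear:
  assumes "ereal_concave G" "bounded (eff_domain G)"
    "marginal_defined G (e + u)" "marginal G (e + u) < ereal m"
    "marginal_defined G (e + l)" "ereal m < marginal G (e + l)" "l \<le> u"
  shows "marginal_defined (window_value G m l u) e" "marginal (window_value G m l u) e = ereal m"
proof -
  obtain k where k: "\<forall>\<^sub>F y in nhds e. window_value G m l u y = ereal (m * y + k)"
    using window_value_eq_linear[OF assms] by blast
  have "((\<lambda>y. m * y + k) has_real_derivative m) (at e)"
    by (auto intro!: derivative_eq_intros)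
  from marginal_smooth[OF k this]
  show "marginal_defined (window_value G m l u) e" "marginal (window_value G m l u) e = ereal m" .
qed

section \<open>Marginal values of a maximum\<close>

lemma marginal_max_dominant:
  assumes dom: "\<forall>\<^sub>F y in nhds e. f2 y \<le> f1 y"
    and f1: "marginal_defined f1 e"
    and left: "marginal f1 e = -\<infinity> \<Longrightarrow> \<forall>y\<in>eff_domain f2. y < e"
  shows "marginal_defined (\<lambda>y. max (f1 y) (f2 y)) e"
    and "marginal (\<lambda>y. max (f1 y) (f2 y)) e = marginal f1 e"
proof -
  let ?f = "\<lambda>y. max (f1 y) (f2 y)"
  have eq: "\<forall>\<^sub>F y in nhds e. ?f y = f1 (y + 0) + ereal 0"
    using dom by eventually_elim (simp add: zero_ereal_def[symmetric] max_absorb1)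
  \<comment> \<open>The union of domains matters at infinite marginal values: a domain point of
    \<open>f1\<close> suffices for \<open>\<infinity>\<close>, but for \<open>-\<infinity>\<close>
    the domain of \<open>f2\<close> must lie left of \<open>e\<close> too.\<close>
  have dom_f: "eff_domain ?f = eff_domain f1 \<union> eff_domain f2"
    by (auto simp: eff_domain_def max_def)
  have right: "\<exists>y\<in>eff_domain ?f. e \<le> y" if inf: "marginal f1 e = \<infinity>"
    using f1 by (cases rule: marginal_definedE)
      (use inf in \<open>auto simp: not_less dom_f split: if_splits\<close>)
  have "\<forall>y\<in>eff_domain f1. y < e" if inf: "marginal f1 e = -\<infinity>"
    using f1 by (cases rule: marginal_definedE) (use inf in \<open>auto split: if_splits\<close>)
  then have left': "\<forall>y\<in>eff_domain ?f. y < e" if "marginal f1 e = -\<infinity>"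
    using that left by (auto simp: dom_f)
  show "marginal_defined ?f e" "marginal ?f e = marginal f1 e"
    using marginal_shift[OF eq] f1 right left' by simp_all
qed

text \<open>\<open>SOME D. False\<close> is what \<open>deriv\<close> returns at a point of non-differentiability.\<close>

lemma marginal_max_kink:
  assumes f1: "marginal_defined f1 e" "marginal f1 e = ereal d1"
    and f2: "marginal_defined f2 e" "marginal f2 e = ereal d2"
  shows "marginal (\<lambda>y. max (f1 y) (f2 y)) e =
    (if f2 e < f1 e then ereal d1 else if f1 e < f2 e then ereal d2
     else if d1 = d2 then ereal d1 else ereal (SOME D. False))"
proof -
  obtain g1 where g1: "\<forall>\<^sub>F y in nhds e. f1 y = ereal (g1 y)" "(g1 has_real_derivative d1) (at e)"
    using f1 by (cases rule: marginal_definedE) (auto split: if_splits)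
  obtain g2 where g2: "\<forall>\<^sub>F y in nhds e. f2 y = ereal (g2 y)" "(g2 has_real_derivative d2) (at e)"
    using f2 by (cases rule: marginal_definedE) (auto split: if_splits)
  have e: "f1 e = ereal (g1 e)" "f2 e = ereal (g2 e)"
    using eventually_nhds_x_imp_x g1(1) g2(1) by fast+
  let ?g = "\<lambda>y. max (g1 y) (g2 y)"
  have ev: "\<forall>\<^sub>F y in nhds e. max (f1 y) (f2 y) = ereal (?g y)"
    using g1(1) g2(1) by eventually_elim simp
  have cont: "(g1 \<longlongrightarrow> g1 e) (nhds e)" "(g2 \<longlongrightarrow> g2 e) (nhds e)"
    using DERIV_isCont[OF g1(2)] DERIV_isCont[OF g2(2)] by (simp_all add: isCont_def tendsto_at_iff_tendsto_nhds)
  consider "g2 e < g1 e" | "g1 e < g2 e" | "g1 e = g2 e"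
    by linarith
  then show ?thesis
  proof cases
    case 1
    have "\<forall>\<^sub>F y in nhds e. g2 y < g1 y"
      using order_tendstoD(1)[OF tendsto_diff[OF cont(1,2)], of 0] 1 by simp
    then have "\<forall>\<^sub>F y in nhds e. max (f1 y) (f2 y) = ereal (g1 y)"
      using ev by eventually_elim simp
    from marginal_smooth(2)[OF this g1(2)] 1 show ?thesis
      by (simp add: e)
  next
    case 2
    have "\<forall>\<^sub>F y in nhds e. g1 y < g2 y"
      using order_tendstoD(1)[OF tendsto_diff[OF cont(2,1)], of 0] 2 by simp
    then have "\<forall>\<^sub>F y in nhds e. max (f1 y) (f2 y) = ereal (g2 y)"
      using ev by eventually_elim simp
    from marginal_smooth(2)[OF this g2(2)] 2 show ?thesis
      by (simp add: e)
  next
    case 3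
    \<comment> \<open>The maximum touches both functions at \<open>e\<close> from above, so any derivative of it
      is a derivative of both.\<close>
    have below: "d1 = D \<and> d2 = D" if D: "(?g has_real_derivative D) (at e)" for D
    proof -
      have "D - d1 = 0"
        using DERIV_local_min[OF DERIV_diff[OF D g1(2)], of 1] 3 by simp
      moreover have "D - d2 = 0"
        using DERIV_local_min[OF DERIV_diff[OF D g2(2)], of 1] 3 by simp
      ultimately show ?thesis
        by simp
    qed
    show ?thesis
    proof (cases "d1 = d2")
      case True
      \<comment> \<open>At a tie each difference quotient of the maximum is one of \<open>g1\<close>
        or of \<open>g2\<close>, and both tend to \<open>d1\<close>.\<close>
      have "(?g has_real_derivative d1) (at e)"
        unfolding has_field_derivative_iff
      proof (rule tendstoI)
        fix r :: real
        assume "0 < r"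
        have "\<forall>\<^sub>F y in at e. dist ((g1 y - g1 e) / (y - e)) d1 < r"
          "\<forall>\<^sub>F y in at e. dist ((g2 y - g2 e) / (y - e)) d1 < r"
          using g1(2) g2(2) True \<open>0 < r\<close> by (auto simp: has_field_derivative_iff dest: tendstoD)
        then show "\<forall>\<^sub>F y in at e. dist ((?g y - ?g e) / (y - e)) d1 < r"
          by eventually_elim (auto simp: 3 max_def)
      qed
      from marginal_smooth(2)[OF ev this] 3 True show ?thesis
        by (simp add: e)
    next
      case False
      have ev': "\<forall>\<^sub>F y in nhds e. real_of_ereal (max (f1 y) (f2 y)) = ?g y"
        using ev by eventually_elim (simp only: real_of_ereal.simps)
      have "marginal (\<lambda>y. max (f1 y) (f2 y)) e = ereal (deriv ?g e)"
        using deriv_cong_ev[OF ev' refl] by (auto simp: marginal_def e max_def)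
      also have "deriv ?g e = (SOME D. False)"
        unfolding deriv_def using below False by (metis (lifting))
      finally show ?thesis
        using 3 False by (simp add: e)
    qed
  qed
qed

subsection \<open>Charging and discharging windows\<close>

text \<open>Since \<open>pc * pd = 0\<close>, a move goes either up, at slope \<open>m\<close>, or
  down, at slope \<open>m'\<close>; idling belongs to both windows.\<close>

definition two_window_value :: "(real \<Rightarrow> ereal) \<Rightarrow> real \<Rightarrow> real \<Rightarrow> real \<Rightarrow> real \<Rightarrow> real \<Rightarrow> ereal" where
  "two_window_value G m m' l u y = max (window_value G m 0 u y) (window_value G m' l 0 y)"

text \<open>The marginal values of \<open>G\<close> at \<open>e + u\<close>, \<open>e\<close> and
  \<open>e + l\<close> are the \<open>a\<close>, \<open>b\<close> and \<open>c\<close> of the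
  theorem.\<close>

locale two_windows =
  fixes G :: "real \<Rightarrow> ereal" and e l u :: real
  assumes conc: "ereal_concave G" and bdd: "bounded (eff_domain G)"
    and l: "l \<le> 0" and u: "0 \<le> u"
    and def_u: "marginal_defined G (e + u)"
    and def_0: "marginal_defined G e"
    and def_l: "marginal_defined G (e + l)"
begin

lemma order: "marginal G (e + u) \<le> marginal G e" "marginal G e \<le> marginal G (e + l)"
  using marginal_antimono[OF conc] def_u def_0 def_l l u by auto

lemma right_window_inactive:
  assumes "marginal G e < ereal m"
  shows "\<forall>\<^sub>F y in nhds e. window_value G m 0 u y = G y"
  using window_value_eq_left[OF conc, of e 0 m u] def_0 assms u
  by (simp add: zero_ereal_def[symmetric])

lemma left_window_inactive:
  assumes "ereal m < marginal G e"
  shows "\<forall>\<^sub>F y in nhds e. window_value G m l 0 y = G y"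
  using window_value_eq_right[OF conc, of e 0 m l] def_0 assms l
  by (simp add: zero_ereal_def[symmetric])

text \<open>A slope below the marginal value at \<open>e + u\<close> makes the right end optimal; a
  slope strictly between this value and the one at \<open>e\<close> makes the window value locally
  linear. The maximum covers both cases.\<close>

lemma marginal_right_window:
  assumes "ereal m \<noteq> marginal G (e + u)" "ereal m < marginal G e"
  shows "marginal_defined (window_value G m 0 u) e"
    and "marginal (window_value G m 0 u) e = max (ereal m) (marginal G (e + u))"
  using window_marginal_right[OF conc def_u, of m 0] u
    window_marginal_linear[OF conc bdd def_u, of m 0] def_0 assms
  by (cases "ereal m < marginal G (e + u)"; auto simp: max_def not_less)+

lemma marginal_left_window:
  assumes "ereal m \<noteq> marginal G (e + l)" "marginal G e < ereal m"
  shows "marginal_defined (window_value G m l 0) e"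
    and "marginal (window_value G m l 0) e = min (ereal m) (marginal G (e + l))"
  using window_marginal_left[OF conc def_l, of m 0] l
    window_marginal_linear[OF conc bdd _ _ def_l, of 0 m] def_0 assms
  by (cases "marginal G (e + l) < ereal m"; auto simp: min_def not_less)+

text \<open>With \<open>m'\<close> below the marginal value at \<open>e\<close>, the discharging
  window is idle near \<open>e\<close>; the charging window contains idling and so
  dominates.\<close>

lemma right_active:
  assumes "ereal m \<noteq> marginal G (e + u)" "ereal m < marginal G e" "ereal m' < marginal G e"
  shows "marginal_defined (two_window_value G m m' l u) e"
    and "marginal (two_window_value G m m' l u) e = max (ereal m) (marginal G (e + u))"
proof -
  have dom: "\<forall>\<^sub>F y in nhds e. window_value G m' l 0 y \<le> window_value G m 0 u y"
    using left_window_inactive[OF assms(3)]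
    by eventually_elim (simp add: window_value_ge_self u)
  have "marginal (window_value G m 0 u) e \<noteq> -\<infinity>"
    using marginal_right_window(2)[OF assms(1,2)] by (auto simp: max_def)
  then show "marginal_defined (two_window_value G m m' l u) e"
    "marginal (two_window_value G m m' l u) e = max (ereal m) (marginal G (e + u))"
    using marginal_max_dominant[OF dom] marginal_right_window[OF assms(1,2)]
    unfolding two_window_value_def[abs_def] by auto
qed

lemma inactive:
  assumes "marginal G e < ereal m" "ereal m' < marginal G e"
  shows "marginal_defined (two_window_value G m m' l u) e"
    and "marginal (two_window_value G m m' l u) e = marginal G e"
proof -
  obtain b where b: "marginal G e = ereal b"
    using assms by (cases "marginal G e") auto
  have eq: "\<forall>\<^sub>F y in nhds e. two_window_value G m m' l u y = G (y + 0) + ereal 0"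
    using left_window_inactive[OF assms(2)] right_window_inactive[OF assms(1)]
    by eventually_elim (simp add: two_window_value_def zero_ereal_def[symmetric])
  show "marginal_defined (two_window_value G m m' l u) e"
    "marginal (two_window_value G m m' l u) e = marginal G e"
    using marginal_shift[OF eq] def_0 b by simp_all
qed

lemma left_active:
  assumes "ereal m' \<noteq> marginal G (e + l)" "marginal G e < ereal m" "marginal G e < ereal m'"
  shows "marginal_defined (two_window_value G m m' l u) e"
    and "marginal (two_window_value G m m' l u) e = min (ereal m') (marginal G (e + l))"
proof -
  have dom: "\<forall>\<^sub>F y in nhds e. window_value G m 0 u y \<le> window_value G m' l 0 y"
    using right_window_inactive[OF assms(2)]
    by eventually_elim (simp add: window_value_ge_self l)
  \<comment> \<open>The minimum is \<open>-\<infinity>\<close> only if the marginal value at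
    \<open>e + l\<close> is, hence also the one at \<open>e\<close>; the charging window, idle near
    \<open>e\<close>, then has its domain left of \<open>e\<close>.\<close>
  have left: "\<forall>y\<in>eff_domain (window_value G m 0 u). y < e"
    if "marginal (window_value G m' l 0) e = -\<infinity>"
  proof -
    have "marginal G e = -\<infinity>"
      using that marginal_left_window(2)[OF assms(1,3)] order(2) by (auto simp: min_def split: if_splits)
    then have inf: "marginal (window_value G m 0 u) e = -\<infinity>"
      and "marginal_defined (window_value G m 0 u) e"
      using window_marginal_left[OF conc, of e 0 m u] def_0 assms(2) u by auto
    from this(2) show ?thesis
      by (cases rule: marginal_definedE) (use inf in \<open>auto split: if_splits\<close>)
  qed
  have comm: "two_window_value G m m' l u
      = (\<lambda>y. max (window_value G m' l 0 y) (window_value G m 0 u y))"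
    by (auto simp: two_window_value_def max.commute)
  show "marginal_defined (two_window_value G m m' l u) e"
    "marginal (two_window_value G m m' l u) e = min (ereal m') (marginal G (e + l))"
    using marginal_max_dominant[OF dom] marginal_left_window[OF assms(1,3)] left
    unfolding comm by auto
qed

text \<open>Moving up and moving down both beat idling, and the larger window decides. A tie is a
  kink unless both windows have the same derivative, which by the ordering means that all three
  marginal values coincide. Serves measurability.\<close>

lemma both_active:
  assumes "ereal m \<noteq> marginal G (e + u)" "ereal m < marginal G e"
    "ereal m' \<noteq> marginal G (e + l)" "marginal G e < ereal m'"
  shows "marginal (two_window_value G m m' l u) e =
    (if window_value G m' l 0 e < window_value G m 0 u e then max (ereal m) (marginal G (e + u))
     else if window_value G m 0 u e < window_value G m' l 0 e then min (ereal m') (marginal G (e + l))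
     else if marginal G (e + u) = marginal G (e + l) then marginal G e
     else ereal (SOME D. False))"
proof -
  obtain b where b: "marginal G e = ereal b"
    using assms(2,4) by (cases "marginal G e") auto
  have "\<exists>d1. max (ereal m) (marginal G (e + u)) = ereal d1"
    using order(1) b assms(2) by (cases "marginal G (e + u)") (auto simp: max_def)
  then obtain d1 where d1: "max (ereal m) (marginal G (e + u)) = ereal d1" ..
  have "\<exists>d2. min (ereal m') (marginal G (e + l)) = ereal d2"
    using order(2) b assms(4) by (cases "marginal G (e + l)") (auto simp: min_def)
  then obtain d2 where d2: "min (ereal m') (marginal G (e + l)) = ereal d2" ..
  have eq: "d1 = d2 \<longleftrightarrow> marginal G (e + u) = marginal G (e + l)"
    and d1b: "marginal G (e + u) = marginal G (e + l) \<Longrightarrow> ereal d1 = marginal G e"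
    using order b assms d1 d2
    by (cases "marginal G (e + u)"; cases "marginal G (e + l)"; auto simp: max_def min_def split: if_splits)+
  show ?thesis
    unfolding two_window_value_def[abs_def]
    using marginal_max_kink[of "window_value G m 0 u" e d1 "window_value G m' l 0" d2]
      marginal_right_window[OF assms(1,2)] marginal_left_window[OF assms(3,4)] d1 d2 eq d1b
    by auto
qed

end

text \<open>Level \<open>x\<close> is reached by \<open>pc = (x - y) / h\<close> or by
  \<open>pd = (x - y) * h\<close>, and the reward then has the stated slopes. The energy bounds are
  absorbed by \<open>admissible_post_value\<close>, which is \<open>-\<infinity>\<close> where they
  fail, so the windows carry only the power bounds.\<close>

lemma bellman_eq_two_window_value:
  fixes S :: "'a ev_model"
  defines "h \<equiv> eff S"
  assumes h: "0 < h" and P: "P_min S t \<le> 0" "0 \<le> P_max S t"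
  shows "bellman S t (post_value S t) p = two_window_value (admissible_post_value S t)
    (p / h) ((p - deg_cost S) * h) (P_min S t / h) (h * P_max S t)"
proof
  fix y
  let ?G = "admissible_post_value S t"
  let ?c = "window_value ?G (p / h) 0 (h * P_max S t) y"
  let ?d = "window_value ?G ((p - deg_cost S) * h) (P_min S t / h) 0 y"
  let ?f = "\<lambda>a. ereal (stage_reward S p a) + post_value S t (next_energy S y a)"
  have "bellman S t (post_value S t) p y \<le> max ?c ?d"
    unfolding bellman_def
  proof (rule SUP_least)
    fix a
    assume a: "a \<in> feasible S t y"
    obtain pc pd where [simp]: "a = (pc, pd)"
      by (cases a)
    define x where "x = y + h * pc + pd / h"
    have x: "next_energy S y a = x"
      by (simp add: x_def next_energy_def h_def)
    have f: "0 \<le> pc" "pc \<le> P_max S t" "P_min S t \<le> pd" "pd \<le> 0" "pc = 0 \<or> pd = 0"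
      and W: "post_value S t x = ?G x"
      using a x by (auto simp: feasible_def admissible_post_value_def)
    show "?f a \<le> max ?c ?d"
    proof (cases "pd = 0")
      case True
      have "stage_reward S p a = - (p / h) * (x - y)"
        using True h by (simp add: stage_reward_def x_def)
      then have "?f a = ?G x + ereal (- (p / h) * (x - y))"
        by (simp only: x W add.commute)
      also have "\<dots> \<le> ?c"
        by (rule window_value_ge) (use True f h in \<open>auto simp: x_def\<close>)
      finally show ?thesis
        by (simp add: le_max_iff_disj)
    next
      case False
      then have [simp]: "pc = 0"
        using f by simp
      have "stage_reward S p a = - ((p - deg_cost S) * h) * (x - y)"
        using h by (simp add: stage_reward_def x_def algebra_simps)
      then have "?f a = ?G x + ereal (- ((p - deg_cost S) * h) * (x - y))"
        by (simp only: x W add.commute)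
      also have "\<dots> \<le> ?d"
        by (rule window_value_ge) (use f h in \<open>auto simp: x_def divide_le_0_iff intro!: divide_right_mono\<close>)
      finally show ?thesis
        by (simp add: le_max_iff_disj)
    qed
  qed
  moreover have "?c \<le> bellman S t (post_value S t) p y"
    unfolding window_value_def
  proof (rule SUP_least)
    fix x
    assume x: "x \<in> {y + 0..y + h * P_max S t}"
    define a where "a = ((x - y) / h, 0::real)"
    have n: "next_energy S y a = x" and r: "stage_reward S p a = - (p / h) * (x - y)"
      using h by (simp_all add: a_def next_energy_def stage_reward_def h_def[symmetric])
    show "?G x + ereal (- (p / h) * (x - y)) \<le> bellman S t (post_value S t) p y"
    proof (cases "E_min S t \<le> x \<and> x \<le> E_max S t")
      case True
      have "a \<in> feasible S t y"
        using True x n h P by (auto simp: feasible_def a_def field_simps)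
      then show ?thesis
        unfolding bellman_def using True n r
        by (intro SUP_upper2[of a]) (auto simp: admissible_post_value_def add.commute)
    qed (auto simp: admissible_post_value_def)
  qed
  moreover have "?d \<le> bellman S t (post_value S t) p y"
    unfolding window_value_def
  proof (rule SUP_least)
    fix x
    assume x: "x \<in> {y + P_min S t / h..y + 0}"
    define a where "a = (0::real, (x - y) * h)"
    have n: "next_energy S y a = x"
      using h by (simp add: a_def next_energy_def h_def[symmetric])
    have r: "stage_reward S p a = - ((p - deg_cost S) * h) * (x - y)"
      by (simp add: a_def stage_reward_def algebra_simps)
    show "?G x + ereal (- ((p - deg_cost S) * h) * (x - y)) \<le> bellman S t (post_value S t) p y"
    proof (cases "E_min S t \<le> x \<and> x \<le> E_max S t")
      case True
      have "P_min S t / h \<le> x - y"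
        using x by simp
      then have "P_min S t \<le> (x - y) * h"
        using h by (simp add: pos_divide_le_eq)
      moreover have "(x - y) * h \<le> 0"
        using x h by (auto intro!: mult_nonpos_nonneg)
      ultimately have "a \<in> feasible S t y"
        using True n P by (auto simp: feasible_def a_def)
      then show ?thesis
        unfolding bellman_def using True n r
        by (intro SUP_upper2[of a]) (auto simp: admissible_post_value_def add.commute)
    qed (auto simp: admissible_post_value_def)
  qed
  ultimately show "bellman S t (post_value S t) p y = two_window_value ?G
      (p / h) ((p - deg_cost S) * h) (P_min S t / h) (h * P_max S t) y"
    unfolding two_window_value_def by (intro antisym) auto
qed

section \<open>Monotonicity of window values in the slope\<close>

lemma window_value_antimono_slope:
  assumes "m1 \<le> m2" "0 \<le> l"
  shows "window_value G m2 l u y \<le> window_value G m1 l u y"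
  unfolding window_value_def using assms
  by (intro SUP_subset_mono order_refl) (auto intro!: add_left_mono mult_right_mono)

lemma window_value_mono_slope:
  assumes "m1 \<le> m2" "u \<le> 0"
  shows "window_value G m1 l u y \<le> window_value G m2 l u y"
  unfolding window_value_def using assms
  by (intro SUP_subset_mono order_refl) (auto intro!: add_left_mono mult_right_mono_neg)

subsection \<open>Distribution of the marginal value\<close>

lemma measurable_up_down_closed:
  fixes U :: "real set"
  assumes "(\<forall>x\<in>U. \<forall>y\<ge>x. y \<in> U) \<or> (\<forall>x\<in>U. \<forall>y\<le>x. y \<in> U)"
  shows "U \<in> sets borel"
  using assms by (intro real_interval_borel_measurable) (auto simp: is_interval_1)

context two_windows
begin

text \<open>Off finitely many prices the marginal value follows the explicit formula
  \<open>w\<close>, and a change at countably many points preserves measurability. The delicate case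
  is the comparison of the two windows.\<close>

lemma marginal_measurable_slope:
  assumes h: "0 < h"
  shows "(\<lambda>p. marginal (two_window_value G (p / h) ((p - k) * h) l u) e) \<in> borel_measurable borel"
proof -
  let ?a = "marginal G (e + u)" and ?b = "marginal G e" and ?c = "marginal G (e + l)"
  let ?C = "\<lambda>p. window_value G (p / h) 0 u e" and ?D = "\<lambda>p. window_value G ((p - k) * h) l 0 e"
  \<comment> \<open>Prices at which a slope hits a marginal value; the strict case lemmas do not
    decide these.\<close>
  define X where "X = {p. ereal (p / h) \<in> {?a, ?b} \<or> ereal ((p - k) * h) \<in> {?b, ?c}}"
  \<comment> \<open>Monotonicity in the price makes the sets where one window beats the other intervals.\<close>
  have C: "?C q \<le> ?C p" and D: "?D p \<le> ?D q" if "p \<le> q" for p q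
    using that h
    by (auto intro!: window_value_antimono_slope[OF _ order_refl] window_value_mono_slope[OF _ order_refl]
        divide_right_mono mult_right_mono)
  have "{p. ?D p < ?C p} \<in> sets borel"
    by (intro measurable_up_down_closed disjI2) (auto intro: le_less_trans[OF D] less_le_trans[OF _ C])
  then have [measurable]: "Measurable.pred borel (\<lambda>p. ?D p < ?C p)"
    by (simp add: pred_def)
  have "{p. ?C p < ?D p} \<in> sets borel"
    by (intro measurable_up_down_closed disjI1) (auto intro: le_less_trans[OF C] less_le_trans[OF _ D])
  then have [measurable]: "Measurable.pred borel (\<lambda>p. ?C p < ?D p)"
    by (simp add: pred_def)
  define w where "w = (\<lambda>p. if ereal (p / h) < ?b then
        if ereal ((p - k) * h) < ?b then max (ereal (p / h)) ?a
        else if ?D p < ?C p then max (ereal (p / h)) ?a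
        else if ?C p < ?D p then min (ereal ((p - k) * h)) ?c
        else if ?a = ?c then ?b else ereal (SOME D. False)
      else if ereal ((p - k) * h) < ?b then ?b else min (ereal ((p - k) * h)) ?c)"
  show ?thesis
  proof (rule measurable_discrete_difference[of w _ _ X])
    show "w \<in> borel_measurable borel"
      unfolding w_def by measurable
    \<comment> \<open>Each equation determines at most one price; for an infinite marginal value
      \<open>real_of_ereal\<close> merely adds a harmless point.\<close>
    have "X \<subseteq> (\<lambda>x. real_of_ereal x * h) ` {?a, ?b} \<union> (\<lambda>x. real_of_ereal x / h + k) ` {?b, ?c}"
      using h by (auto simp: X_def image_iff dest: sym)
    then show "countable X"
      by (rule countable_subset) auto
  next
    fix p :: real
    assume "p \<notin> X"
    then show "w p = marginal (two_window_value G (p / h) ((p - k) * h) l u) e"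
      using right_active(2)[of "p / h" "(p - k) * h"] inactive(2)[of "p / h" "(p - k) * h"]
        left_active(2)[of "(p - k) * h" "p / h"] both_active[of "p / h" "(p - k) * h"]
      by (auto simp: w_def X_def not_less order.order_iff_strict)
  qed auto
qed

end

text \<open>\<open>w\<close> clamps the charging slope below at \<open>a\<close>, idles at
  \<open>b\<close> and clamps the discharging slope above at \<open>c\<close>. Its flat pieces
  produce the point masses, its two linear pieces the densities. It is prescribed only off ties and
  off prices with both windows active; the latter are null by \<open>mass\<close>.\<close>

lemma clamped_distribution:
  fixes f :: "real \<Rightarrow> real" and X :: "'a \<Rightarrow> real" and w :: "real \<Rightarrow> ereal" and a b c :: ereal
  assumes M: "prob_space M" and h: "0 < h"
    and X: "distributed M lborel X (\<lambda>x. ennreal (f x))" and f0: "\<And>x. 0 \<le> f x"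
    and ord: "a \<le> b" "b \<le> c"
    and w[measurable]: "w \<in> borel_measurable borel"
    and charge: "\<forall>p. ereal (p / h) \<noteq> a \<and> ereal (p / h) < b \<and> ereal ((p - k) * h) < b \<longrightarrow>
      w p = max (ereal (p / h)) a"
    and idle: "\<forall>p. b < ereal (p / h) \<and> ereal ((p - k) * h) < b \<longrightarrow> w p = b"
    and discharge: "\<forall>p. ereal ((p - k) * h) \<noteq> c \<and> b < ereal (p / h) \<and> b < ereal ((p - k) * h) \<longrightarrow>
      w p = min (ereal ((p - k) * h)) c"
  defines "F \<equiv> \<lambda>y. measure (distr M borel X) {x. ereal x \<le> y}"
  assumes mass: "F (ereal h * b) \<le> F (b / ereal h + ereal k)"
    and A: "A \<in> sets borel"
  shows "AE \<omega> in M. ereal (X \<omega> / h) \<notin> {a, b} \<and> ereal ((X \<omega> - k) * h) \<notin> {b, c} \<and>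
      (ereal (X \<omega> / h) < b \<longrightarrow> ereal ((X \<omega> - k) * h) < b)" (is ?th1)
    and "emeasure (distr M borel (\<lambda>\<omega>. w (X \<omega>))) A =
        ennreal (F (ereal h * a)) * indicator A a
      + (\<integral>\<^sup>+x. ennreal (h * f (h * x)) * indicator (A \<inter> {a<..<b}) (ereal x) \<partial>lborel)
      + ennreal (F (b / ereal h + ereal k) - F (ereal h * b)) * indicator A b
      + (\<integral>\<^sup>+x. ennreal (1 / h * f (x / h + k)) * indicator (A \<inter> {b<..<c}) (ereal x) \<partial>lborel)
      + ennreal (1 - F (c / ereal h + ereal k)) * indicator A c" (is ?th2)
proof -
  interpret prob_space M by (rule M)
  note [measurable] = A
  have Xm[measurable]: "X \<in> borel_measurable M"
    using distributed_measurable[OF X] by simp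
  have fm: "(\<lambda>x. ennreal (f x)) \<in> borel_measurable borel"
    using distributed_borel_measurable[OF X] by simp
  have f[measurable]: "f \<in> borel_measurable borel"
    using borel_measurable_enn2real[OF fm] f0 by simp
  define N where "N = distr M borel X"
  interpret N: prob_space N
    unfolding N_def by (rule prob_space_distr) simp
  have N_dens: "N = density lborel (\<lambda>x. ennreal (f x))"
    unfolding N_def using distributed_distr_eq_density[OF X] by (metis distr_cong sets_lborel)
  have sN[measurable_cong]: "sets N = sets borel"
    by (simp add: N_def)
  have spN: "space N = UNIV"
    by (simp add: N_def)
  have F: "F y = measure N {x. ereal x \<le> y}" for y
    by (simp add: F_def N_def)
  \<comment> \<open>As \<open>h > 0\<close>, these rescalings preserve order even for infinite
    \<open>y\<close>, so \<open>F\<close> at such arguments measures a set of prices described by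
    its slope.\<close>
  have low: "ereal x \<le> ereal h * y \<longleftrightarrow> ereal (x / h) \<le> y" for x y
    using h by (cases y) (auto simp: field_simps)
  have high: "ereal x \<le> y / ereal h + ereal k \<longleftrightarrow> ereal ((x - k) * h) \<le> y" for x y
    using h by (cases y) (auto simp: field_simps)
  have Fl: "F (ereal h * y) = measure N {x. ereal (x / h) \<le> y}" for y
    by (simp add: F low)
  have Fh: "F (y / ereal h + ereal k) = measure N {x. ereal ((x - k) * h) \<le> y}" for y
    by (simp add: F high)
  have [measurable]: "{x. ereal (x / h) \<le> y} \<in> sets borel" "{x. ereal ((x - k) * h) \<le> y} \<in> sets borel"
    for y by measurable
  \<comment> \<open>Contains all tie prices and is finite, hence null because \<open>N\<close> has a
    density.\<close>
  define Z where "Z = (\<lambda>x. real_of_ereal x * h) ` {a, b} \<union> (\<lambda>x. real_of_ereal x / h + k) ` {b, c}"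
  have Z: "ereal (x / h) \<notin> {a, b} \<and> ereal ((x - k) * h) \<notin> {b, c}" if "x \<notin> Z" for x
    using that h by (auto simp: Z_def dest: sym)
  have "AE x in lborel. x \<notin> Z"
    by (intro AE_not_in finite_imp_null_set_lborel) (simp add: Z_def)
  then have aeZ: "AE x in N. x \<notin> Z"
    unfolding N_dens by (subst AE_density) auto
  let ?L = "{x. ereal (x / h) \<le> b}" and ?H = "{x. ereal ((x - k) * h) \<le> b}"
  \<comment> \<open>Half-lines for finite \<open>b\<close>; for infinite \<open>b\<close> both sets
    are empty or everything.\<close>
  have nest: "?L \<subseteq> ?H \<or> ?H \<subseteq> ?L"
  proof (cases b)
    case (real r)
    then have "?L = {..r * h}" "?H = {..r / h + k}"
      using h by (auto simp: field_simps)
    then show ?thesis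
      by auto
  qed auto
  \<comment> \<open>\<open>mass\<close> makes the set where both windows are active null.\<close>
  have gap: "measure N (?H - ?L) = F (b / ereal h + ereal k) - F (ereal h * b)"
    and overlap: "measure N (?L - ?H) = 0"
  proof -
    have "measure N (?H - ?L) = F (b / ereal h + ereal k) - F (ereal h * b) \<and> measure N (?L - ?H) = 0"
    proof (cases "?L \<subseteq> ?H")
      case True
      then have "?L - ?H = {}"
        by blast
      then have "measure N (?L - ?H) = 0"
        by (simp only: measure_empty)
      then show ?thesis
        using N.finite_measure_Diff[of ?H ?L] True by (simp add: Fl Fh sN)
    next
      case False
      then have sub: "?H \<subseteq> ?L"
        using nest by blast
      have "measure N ?H = measure N ?L"
        using mass N.finite_measure_mono[OF sub] by (simp add: Fl Fh sN)
      moreover have "?H - ?L = {}"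
        using sub by blast
      then have "measure N (?H - ?L) = 0"
        by (simp only: measure_empty)
      ultimately show ?thesis
        using N.finite_measure_Diff[of ?L ?H] sub by (simp add: Fl Fh sN)
    qed
    then show "measure N (?H - ?L) = F (b / ereal h + ereal k) - F (ereal h * b)"
      "measure N (?L - ?H) = 0" by auto
  qed
  have "AE x in N. x \<notin> ?L - ?H"
    by (rule AE_not_in) (simp add: null_sets_def N.emeasure_eq_measure overlap sN)
  with aeZ have ae: "AE x in N. ereal (x / h) \<notin> {a, b} \<and> ereal ((x - k) * h) \<notin> {b, c} \<and>
      (ereal (x / h) < b \<longrightarrow> ereal ((x - k) * h) < b)"
    by eventually_elim (use Z in \<open>force simp: order.order_iff_strict\<close>)
  then show ?th1
    unfolding N_def by (subst (asm) AE_distr_iff) auto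
  define I where "I = (indicator :: ereal set \<Rightarrow> ereal \<Rightarrow> ennreal) A"
  have [measurable]: "I \<in> borel_measurable borel"
    unfolding I_def by measurable
  \<comment> \<open>Almost every price activates exactly one summand: saturated charging, partial
    charging, idling, partial discharging, saturated discharging.\<close>
  have split: "AE x in N. I (w x) =
      I a * indicator {x. ereal (x / h) \<le> a} x
      + I (ereal (x / h)) * indicator {a<..<b} (ereal (x / h))
      + I b * indicator (?H - ?L) x
      + I (ereal ((x - k) * h)) * indicator {b<..<c} (ereal ((x - k) * h))
      + I c * indicator (- {x. ereal ((x - k) * h) \<le> c}) x"
    using ae
  proof eventually_elim
    case (elim x)
    consider "ereal (x / h) < b" "ereal ((x - k) * h) < b"
      | "b < ereal (x / h)" "ereal ((x - k) * h) < b"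
      | "b < ereal (x / h)" "b < ereal ((x - k) * h)"
      using elim by force
    then show ?case
    proof cases
      case 1
      moreover from 1 have "ereal ((x - k) * h) < c"
        using ord by auto
      ultimately show ?thesis
        using charge[rule_format, of x] elim ord by (auto simp: indicator_def max_def not_less not_le)
    next
      case 2
      moreover from 2 have "ereal ((x - k) * h) < c" "a < ereal (x / h)"
        using ord by auto
      ultimately show ?thesis
        using idle[rule_format, of x] elim ord by (auto simp: indicator_def max_def not_less not_le)
    next
      case 3
      moreover from 3 have "a < ereal (x / h)" "a < ereal ((x - k) * h)"
        using ord by auto
      ultimately show ?thesis
        using discharge[rule_format, of x] elim ord by (auto simp: indicator_def min_def not_less not_le)
    qed
  qed
  have emN: "(\<integral>\<^sup>+x. K * indicator B x \<partial>N) = ennreal (measure N B) * K" if "B \<in> sets borel" for B K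
    using that by (subst nn_integral_cmult_indicator) (auto simp: sN N.emeasure_eq_measure mult.commute)
  have "emeasure (distr M borel (\<lambda>\<omega>. w (X \<omega>))) A = emeasure (distr N borel w) A"
    unfolding N_def by (subst distr_distr) (auto simp: comp_def)
  also have "\<dots> = (\<integral>\<^sup>+x. I (w x) \<partial>N)"
    by (subst nn_integral_indicator[symmetric], simp, subst nn_integral_distr) (auto simp: I_def)
  also have "\<dots> = (\<integral>\<^sup>+x. I a * indicator {x. ereal (x / h) \<le> a} x
      + I (ereal (x / h)) * indicator {a<..<b} (ereal (x / h))
      + I b * indicator (?H - ?L) x
      + I (ereal ((x - k) * h)) * indicator {b<..<c} (ereal ((x - k) * h))
      + I c * indicator (- {x. ereal ((x - k) * h) \<le> c}) x \<partial>N)"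
    using split by (rule nn_integral_cong_AE)
  also have "\<dots> = (\<integral>\<^sup>+x. I a * indicator {x. ereal (x / h) \<le> a} x \<partial>N)
      + (\<integral>\<^sup>+x. I (ereal (x / h)) * indicator {a<..<b} (ereal (x / h)) \<partial>N)
      + (\<integral>\<^sup>+x. I b * indicator (?H - ?L) x \<partial>N)
      + (\<integral>\<^sup>+x. I (ereal ((x - k) * h)) * indicator {b<..<c} (ereal ((x - k) * h)) \<partial>N)
      + (\<integral>\<^sup>+x. I c * indicator (- {x. ereal ((x - k) * h) \<le> c}) x \<partial>N)"
    by (simp add: nn_integral_add)
  also have "(\<integral>\<^sup>+x. I a * indicator {x. ereal (x / h) \<le> a} x \<partial>N) = ennreal (F (ereal h * a)) * I a"
    by (subst emN) (simp_all add: Fl)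
  also have "(\<integral>\<^sup>+x. I b * indicator (?H - ?L) x \<partial>N)
      = ennreal (F (b / ereal h + ereal k) - F (ereal h * b)) * I b"
    by (subst emN) (simp_all add: gap)
  also have "(\<integral>\<^sup>+x. I c * indicator (- {x. ereal ((x - k) * h) \<le> c}) x \<partial>N)
      = ennreal (1 - F (c / ereal h + ereal k)) * I c"
    using N.prob_compl[of "{x. ereal ((x - k) * h) \<le> c}"]
    by (subst emN) (simp_all add: Fh sN spN Compl_eq_Diff_UNIV)
  also have "(\<integral>\<^sup>+x. I (ereal (x / h)) * indicator {a<..<b} (ereal (x / h)) \<partial>N)
      = (\<integral>\<^sup>+x. ennreal (f x) * (I (ereal (x / h)) * indicator {a<..<b} (ereal (x / h))) \<partial>lborel)"
    unfolding N_dens by (subst nn_integral_density) auto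
  \<comment> \<open>The marginal value \<open>x\<close> corresponds to the price
    \<open>h * x\<close>, with Jacobian \<open>h\<close>.\<close>
  also have "\<dots> = (\<integral>\<^sup>+x. ennreal (h * f (h * x)) * indicator (A \<inter> {a<..<b}) (ereal x) \<partial>lborel)"
    using h f0
    by (subst nn_integral_real_affine[where c = h and t = 0])
      (auto simp: nn_integral_cmult[symmetric] I_def indicator_inter_arith ennreal_mult mult_ac
        intro!: nn_integral_cong)
  also have "(\<integral>\<^sup>+x. I (ereal ((x - k) * h)) * indicator {b<..<c} (ereal ((x - k) * h)) \<partial>N)
      = (\<integral>\<^sup>+x. ennreal (f x) * (I (ereal ((x - k) * h)) * indicator {b<..<c} (ereal ((x - k) * h))) \<partial>lborel)"
    unfolding N_dens by (subst nn_integral_density) auto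
  \<comment> \<open>Here the price is \<open>x / h + k\<close>, with Jacobian
    \<open>1 / h\<close>.\<close>
  also have "\<dots> = (\<integral>\<^sup>+x. ennreal (1 / h * f (x / h + k)) * indicator (A \<inter> {b<..<c}) (ereal x) \<partial>lborel)"
    using h f0
    by (subst nn_integral_real_affine[where c = "1 / h" and t = k])
      (auto simp: nn_integral_cmult[symmetric] I_def indicator_inter_arith ennreal_mult mult_ac add.commute
        simp del: times_divide_eq_left intro!: nn_integral_cong)
  finally show ?th2
    by (simp only: I_def)
qed

text \<open>Extended reals cover window ends beyond the energy bounds: for
  \<open>a = -\<infinity>\<close> or \<open>c = \<infinity>\<close> the point mass there is 0. The
  hypothesis \<open>nonneg_mass\<close> says that the mass claimed at \<open>b\<close> is not
  negative. This is automatic for \<open>b \<ge> 0\<close>; for negative \<open>b\<close> there may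
  be prices at which charging and discharging are both profitable.\<close>

theorem mainTheorem2:
  fixes S :: "'a ev_model" and t :: nat and e :: real and a b c :: ereal
  defines "a \<equiv> v_post S t (e + eff S * P_max S t)"
    and "b \<equiv> v_post S t e"
    and "c \<equiv> v_post S t (e + P_min S t / eff S)"
  assumes "ev_setting S"
    and "t \<in> {1..horizon S}"
    and "ereal_concave (admissible_post_value S t)"
    and "\<forall>x\<in>{e + eff S * P_max S t, e, e + P_min S t / eff S}.
           marginal_defined (admissible_post_value S t) x"
    and nonneg_mass: "price_cdf S t (ereal (eff S) * b) \<le>
           price_cdf S t (b / ereal (eff S) + ereal (deg_cost S))"
  shows "(AE \<omega> in prob_sp S. marginal_defined (value_fun S t \<omega>) e) \<and>
    v_stage S t e \<in> borel_measurable (prob_sp S) \<and>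
    (\<forall>A\<in>sets borel. emeasure (distr (prob_sp S) borel (v_stage S t e)) A =
        ennreal (price_cdf S t (ereal (eff S) * a)) * indicator A a
      + (\<integral>\<^sup>+x. ennreal (eff S * price_density S t (eff S * x))
            * indicator (A \<inter> {a<..<b}) (ereal x) \<partial>lborel)
      + ennreal (price_cdf S t (b / ereal (eff S) + ereal (deg_cost S))
            - price_cdf S t (ereal (eff S) * b)) * indicator A b
      + (\<integral>\<^sup>+x. ennreal (1 / eff S * price_density S t (x / eff S + deg_cost S))
            * indicator (A \<inter> {b<..<c}) (ereal x) \<partial>lborel)
      + ennreal (1 - price_cdf S t (c / ereal (eff S) + ereal (deg_cost S))) * indicator A c)"
proof -
  define h where "h = eff S"
  let ?G = "admissible_post_value S t" and ?k = "deg_cost S"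
  have M: "prob_space (prob_sp S)" and h: "0 < h"
    and P: "P_min S t \<le> 0" "0 \<le> P_max S t" and f0: "\<And>x. 0 \<le> price_density S t x"
    and X: "distributed (prob_sp S) lborel (price S t) (\<lambda>x. ennreal (price_density S t x))"
    using assms(4,5) by (auto simp: ev_setting_def h_def)
  have "eff_domain ?G \<subseteq> {E_min S t..E_max S t}"
    by (auto simp: eff_domain_def admissible_post_value_def split: if_splits)
  then have bdd: "bounded (eff_domain ?G)"
    using bounded_subset bounded_closed_interval by blast
  interpret W: two_windows ?G e "P_min S t / h" "h * P_max S t"
    using assms(6,7) bdd h P by unfold_locales (auto simp: h_def divide_nonpos_pos)
  define w where "w = (\<lambda>p. marginal
    (two_window_value ?G (p / h) ((p - ?k) * h) (P_min S t / h) (h * P_max S t)) e)"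
  have V: "value_fun S t \<omega> = two_window_value ?G (price S t \<omega> / h) ((price S t \<omega> - ?k) * h)
      (P_min S t / h) (h * P_max S t)" for \<omega>
    using bellman_eq_two_window_value[of S t] h P
    by (auto simp: value_fun_def[abs_def] h_def fun_eq_iff)
  have v: "v_stage S t e = (\<lambda>\<omega>. w (price S t \<omega>))"
    by (simp add: v_stage_def[abs_def] V w_def)
  have abc: "a = marginal ?G (e + h * P_max S t)" "b = marginal ?G e"
    "c = marginal ?G (e + P_min S t / h)"
    by (simp_all add: a_def b_def c_def v_post_def h_def)
  have w_meas: "w \<in> borel_measurable borel"
    unfolding w_def by (rule W.marginal_measurable_slope[OF h])
  have regions:
    "\<forall>p. ereal (p / h) \<noteq> a \<and> ereal (p / h) < b \<and> ereal ((p - ?k) * h) < b \<longrightarrow>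
      w p = max (ereal (p / h)) a"
    "\<forall>p. b < ereal (p / h) \<and> ereal ((p - ?k) * h) < b \<longrightarrow> w p = b"
    "\<forall>p. ereal ((p - ?k) * h) \<noteq> c \<and> b < ereal (p / h) \<and> b < ereal ((p - ?k) * h) \<longrightarrow>
      w p = min (ereal ((p - ?k) * h)) c"
    unfolding w_def abc using W.right_active(2) W.inactive(2) W.left_active(2) by auto
  have mass: "measure (distr (prob_sp S) borel (price S t)) {x. ereal x \<le> ereal h * b}
      \<le> measure (distr (prob_sp S) borel (price S t)) {x. ereal x \<le> b / ereal h + ereal ?k}"
    using nonneg_mass by (simp add: price_cdf_def h_def)
  note clamped = clamped_distribution[OF M h X f0 W.order[folded abc] w_meas regions mass]
  \<comment> \<open>Almost every price lies in one of three regions, each with its own lemma on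
    \<open>marginal_defined\<close>. The whole space serves as the Borel set that
    \<open>clamped_distribution\<close> asks for.\<close>
  have "AE \<omega> in prob_sp S. marginal_defined (value_fun S t \<omega>) e"
    using clamped(1)[OF space_in_borel]
  proof eventually_elim
    case (elim \<omega>)
    then consider "ereal (price S t \<omega> / h) < b" "ereal ((price S t \<omega> - ?k) * h) < b"
      | "b < ereal (price S t \<omega> / h)" "ereal ((price S t \<omega> - ?k) * h) < b"
      | "b < ereal (price S t \<omega> / h)" "b < ereal ((price S t \<omega> - ?k) * h)"
      by force
    then show ?case
      using elim W.right_active(1) W.inactive(1) W.left_active(1) unfolding V abc by cases auto
  qed
  moreover have "v_stage S t e \<in> borel_measurable (prob_sp S)"
    using distributed_measurable[OF X] w_meas by (simp add: v measurable_compose)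
  moreover note clamped(2)
  ultimately show ?thesis
    unfolding v price_cdf_def h_def by blast
qed

end
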